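(* For $\ell \geq 1$ and $n \geq 2\ell+1$, $$\gamma(P^\ell_n,x) = x\sum_{j=1}^{2\ell+1} \gamma(P^\ell_{n-j},x).$$ For $\ell \geq 1$ and $n \geq 2\ell+2$, $$\gamma(C^\ell_n,x) = x\sum_{j=1}^{2\ell+1} \gamma(C^\ell_{n-j},x).$$
   Context: A dominating set in a graph $G$ is a set $D$ of vertices such that every vertex of $G$ is in $D$ or adjacent to a vertex of $D$. $\gamma_k(G)$ denotes the number of dominating sets of $G$ of size $k$, and the domination polynomial is $\gamma(G,x)=\sum_{k\geq 0}\gamma_k(G)x^k$. For a graph $G$ and positive integer $\ell$, the $\ell$th power of $G$ is the graph on the same vertex set in which two distinct vertices are adjacent iff their distance in $G$ is at most $\ell$. $P^\ell_n$ is the $\ell$th power of the path on $n$ vertices and $C^\ell_n$ is the $\ell$th power of the cycle on $n$ vertices. By convention $P^\ell_0$ and $C^\ell_0$ are the graph with no vertices (so their domination polynomial is $1$), $C^\ell_1$ is a single isolated vertex, and $C^\ell_2$ is the complete graph on two vertices. *)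

theory Defs
  imports
    "Graph_Theory.Pair_Digraph"
    "Graph_Theory.Shortest_Path"
    "HOL-Computational_Algebra.Polynomial"
begin

text \<open>
  A simple graph is a record \<open>pair_pre_digraph\<close> whose arc relation is irreflexive and
  symmetric (locale \<open>pair_graph\<close>): every undirected edge is stored as its two arcs.
  A graph may have no vertices.
\<close>

text \<open>
  With unit weights \<open>\<mu>\<close> is the infimum of the lengths of all walks from \<open>u\<close> to \<open>v\<close>;
  it is \<open>\<infinity>\<close> if there is none.
\<close>

definition graph_dist :: "'a pair_pre_digraph \<Rightarrow> 'a \<Rightarrow> 'a \<Rightarrow> ereal" where
  "graph_dist G u v = wf_digraph.\<mu> (with_proj G) (\<lambda>_. 1) u v"

definition graph_power :: "'a pair_pre_digraph \<Rightarrow> nat \<Rightarrow> 'a pair_pre_digraph" where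
  "graph_power G l =
     \<lparr> pverts = pverts G,
       parcs = {(u, v). u \<in> pverts G \<and> v \<in> pverts G \<and> u \<noteq> v \<and>
                        graph_dist G u v \<le> ereal (real l)} \<rparr>"

definition dominating_set :: "'a pair_pre_digraph \<Rightarrow> 'a set \<Rightarrow> bool" where
  "dominating_set G D \<longleftrightarrow>
     D \<subseteq> pverts G \<and> (\<forall>v \<in> pverts G. v \<in> D \<or> (\<exists>u \<in> D. (v, u) \<in> parcs G))"

definition num_dominating_sets :: "'a pair_pre_digraph \<Rightarrow> nat \<Rightarrow> nat" where
  "num_dominating_sets G k = card {D. dominating_set G D \<and> card D = k}"

text \<open>For finite \<open>G\<close> the coefficients beyond \<open>card (pverts G)\<close> vanish.\<close>

definition domination_poly :: "'a pair_pre_digraph \<Rightarrow> int poly" where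
  "domination_poly G =
     (\<Sum>k \<le> card (pverts G). monom (int (num_dominating_sets G k)) k)"

definition path_graph :: "nat \<Rightarrow> nat pair_pre_digraph" where
  "path_graph n =
     \<lparr> pverts = {..<n},
       parcs = {(i, j). i < n \<and> j < n \<and> (j = i + 1 \<or> i = j + 1)} \<rparr>"

text \<open>
  The condition \<open>i \<noteq> j\<close> only matters for \<open>n = 1\<close>, where it removes the loop.
\<close>

definition cycle_graph :: "nat \<Rightarrow> nat pair_pre_digraph" where
  "cycle_graph n =
     \<lparr> pverts = {..<n},
       parcs = {(i, j). i < n \<and> j < n \<and> i \<noteq> j \<and>
                        (j = (i + 1) mod n \<or> i = (j + 1) mod n)} \<rparr>"

abbreviation path_power :: "nat \<Rightarrow> nat \<Rightarrow> nat pair_pre_digraph" where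
  "path_power l n \<equiv> graph_power (path_graph n) l"

abbreviation cycle_power :: "nat \<Rightarrow> nat \<Rightarrow> nat pair_pre_digraph" where
  "cycle_power l n \<equiv> graph_power (cycle_graph n) l"

lemma coeff_domination_poly:
  assumes "finite (pverts G)"
  shows "coeff (domination_poly G) k = int (num_dominating_sets G k)"
proof (cases "k \<le> card (pverts G)")
  case True
  then show ?thesis
    by (simp add: domination_poly_def coeff_sum)
next
  case False
  then have "{D. dominating_set G D \<and> card D = k} = {}"
    using card_mono[OF assms] by (auto simp: dominating_set_def)
  then have "num_dominating_sets G k = 0"
    by (simp only: num_dominating_sets_def card.empty)
  with False show ?thesis
    by (simp add: domination_poly_def coeff_sum)
qed

lemma pair_graphI:
  assumes "finite (pverts G)" "parcs G \<subseteq> pverts G \<times> pverts G" "irrefl (parcs G)" "sym (parcs G)"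
  shows "pair_graph G"
proof unfold_locales
  show "finite (parcs G)"
    using assms(1,2) by (meson finite_SigmaI finite_subset)
  show "symmetric (with_proj G)"
    using assms(4) by (simp add: symmetric_def)
qed (use assms in \<open>auto simp: irrefl_def\<close>)

lemma pair_graph_path_graph: "pair_graph (path_graph n)"
  by (rule pair_graphI) (auto simp: path_graph_def irrefl_def sym_def)

lemma pair_graph_cycle_graph: "pair_graph (cycle_graph n)"
  by (rule pair_graphI) (auto simp: cycle_graph_def irrefl_def sym_def)

lemma cycle_graph_1: "cycle_graph 1 = \<lparr> pverts = {0}, parcs = {} \<rparr>"
  by (auto simp: cycle_graph_def)

lemma cycle_graph_2: "cycle_graph 2 = \<lparr> pverts = {0, 1}, parcs = {(0, 1), (1, 0)} \<rparr>"
  by (auto simp: cycle_graph_def less_2_cases_iff)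

lemma domination_poly_no_vertices:
  assumes "pverts G = {}"
  shows "domination_poly G = 1"
proof -
  have "{D. dominating_set G D \<and> card D = 0} = {{}}"
    using assms by (auto simp: dominating_set_def)
  then have "num_dominating_sets G 0 = 1"
    by (simp add: num_dominating_sets_def)
  then show ?thesis
    using assms by (simp add: domination_poly_def)
qed

end

theory Submission
  imports Defs
begin

text \<open>
  A nonempty set \<open>D\<close> dominates the \<open>l\<close>th power of a path or cycle iff consecutive elements differ
  by at most \<open>2 * l + 1\<close> and the two ends fit: \<open>Min D \<le> l\<close> and \<open>n - Max D \<le> l + 1\<close> for
  the path, \<open>Min D + (n - Max D) \<le> 2 * l + 1\<close> for the cycle. Deleting \<open>Max D\<close> together with the
  \<open>j\<close> vertices of the last gap keeps \<open>Min D\<close> and \<open>n - Max D\<close>, so it is a bijection between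
  the dominating sets with at least two elements and the pairs of some \<open>j \<in> {1..2 * l + 1}\<close> and a
  nonempty dominating set on \<open>n - j\<close> vertices. It remains to inspect singletons and the empty graph.
\<close>

section \<open>Distances in paths and cycles\<close>

text \<open>An infimum yields a witness only below a strict bound. Walk lengths are integers, so
  passing from \<open>l\<close> to the strict bound \<open>Suc l\<close> loses nothing and no
  attained minimum has to be exhibited.\<close>

lemma graph_dist_le_iff:
  assumes "pair_wf_digraph G"
  shows "graph_dist G u v \<le> ereal (real l) \<longleftrightarrow>
    (\<exists>p. pre_digraph.awalk (with_proj G) u p v \<and> length p \<le> l)"
proof -
  interpret pair_wf_digraph G by fact
  have cost: "awalk_cost (\<lambda>_. 1) p = real (length p)" for p :: "('a \<times> 'a) list"
    by (induction p) auto
  show ?thesis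
  proof
    assume "graph_dist G u v \<le> ereal (real l)"
    also have "\<dots> < ereal (real (Suc l))" by simp
    finally have "(INF p\<in>{p. awalk u p v}. ereal (real (length p))) < ereal (real (Suc l))"
      by (simp add: graph_dist_def \<mu>_def cost)
    then obtain p where "awalk u p v" "ereal (real (length p)) < ereal (real (Suc l))"
      unfolding INF_less_iff by auto
    then show "\<exists>p. awalk u p v \<and> length p \<le> l" by auto
  next
    assume "\<exists>p. awalk u p v \<and> length p \<le> l"
    then obtain p where p: "awalk u p v" "length p \<le> l" by auto
    have "graph_dist G u v \<le> ereal (real (length p))"
      using min_cost_le_walk_cost[OF p(1), of "\<lambda>_. 1"] by (simp add: graph_dist_def cost)
    also have "\<dots> \<le> ereal (real l)" using p(2) by simp
    finally show "graph_dist G u v \<le> ereal (real l)" .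
  qed
qed

lemma pverts_simps [simp]:
  "pverts (path_graph n) = {..<n}" "pverts (cycle_graph n) = {..<n}"
  "pverts (graph_power G l) = pverts G"
  by (simp_all add: path_graph_def cycle_graph_def graph_power_def)

lemma parcs_path_graph_iff:
  "(i, j) \<in> parcs (path_graph n) \<longleftrightarrow> i < n \<and> j < n \<and> (j = i + 1 \<or> i = j + 1)"
  by (simp add: path_graph_def)

text \<open>Walking straight up or down realises the difference of the two numbers, and no walk is
  shorter because each arc changes the number by exactly one.\<close>

lemma path_graph_dist_le_iff:
  assumes "u < n" "v < n"
  shows "graph_dist (path_graph n) u v \<le> ereal (real l) \<longleftrightarrow> \<bar>int u - int v\<bar> \<le> int l"
proof -
  interpret pair_graph "path_graph n" by (rule pair_graph_path_graph)
  have up: "\<exists>p. awalk a p (a + d) \<and> length p = d" if "a + d < n" for a d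
    using that
  proof (induction d arbitrary: a)
    case 0
    then show ?case by (auto simp: awalk_Nil_iff)
  next
    case (Suc d)
    then obtain p where "awalk (Suc a) p (Suc a + d)" "length p = d"
      using Suc.IH[of "Suc a"] by auto
    with Suc.prems show ?case
      by (intro exI[of _ "(a, Suc a) # p"]) (auto simp: awalk_Cons_iff parcs_path_graph_iff)
  qed
  have down: "\<exists>p. awalk (a + d) p a \<and> length p = d" if "a + d < n" for a d
    using that
  proof (induction d)
    case 0
    then show ?case by (auto simp: awalk_Nil_iff)
  next
    case (Suc d)
    then obtain p where "awalk (a + d) p a" "length p = d" by fastforce
    with Suc.prems show ?case
      by (intro exI[of _ "(a + Suc d, a + d) # p"]) (auto simp: awalk_Cons_iff parcs_path_graph_iff)
  qed
  have bound: "\<bar>int a - int v\<bar> \<le> int (length p)" if "awalk a p v" for a p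
    using that
  proof (induction p arbitrary: a)
    case Nil
    then show ?case by (simp add: awalk_Nil_iff)
  next
    case (Cons e p)
    then have "e \<in> parcs (path_graph n)" "a = fst e" "awalk (snd e) p v"
      by (auto simp: awalk_Cons_iff)
    with Cons.IH[of "snd e"] show ?case by (auto simp: path_graph_def)
  qed
  have "\<exists>p. awalk u p v \<and> length p \<le> l" if "\<bar>int u - int v\<bar> \<le> int l"
  proof (cases "u \<le> v")
    case True
    with up[of u "v - u"] that assms show ?thesis by fastforce
  next
    case False
    with down[of v "u - v"] that assms show ?thesis by fastforce
  qed
  moreover have "\<bar>int u - int v\<bar> \<le> int l" if "awalk u p v" "length p \<le> l" for p
    using bound[OF that(1)] that(2) by linarith
  ultimately show ?thesis
    unfolding graph_dist_le_iff[OF pair_wf_digraph_axioms] by blast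
qed

text \<open>The integer \<open>i\<close> is the signed displacement of a walk: each arc adds or
  subtracts one modulo \<open>n\<close>. Using displacements instead of a circular distance avoids
  cases for small \<open>n\<close> and for wrapping around. The disjunct \<open>u = v\<close>
  confines the construction of walks to distinct vertices, hence to \<open>n \<ge> 2\<close>; a
  cycle on one vertex has no arcs to walk along.\<close>

lemma cycle_graph_dist_le_iff:
  assumes "u < n" "v < n"
  shows "u = v \<or> graph_dist (cycle_graph n) u v \<le> ereal (real l) \<longleftrightarrow>
    (\<exists>i. \<bar>i\<bar> \<le> int l \<and> int v = (int u + i) mod int n)"
    (is "?L \<longleftrightarrow> ?R")
proof -
  interpret pair_graph "cycle_graph n" by (rule pair_graph_cycle_graph)
  have arcs: "(a, Suc a mod n) \<in> parcs (cycle_graph n)" "(Suc a mod n, a) \<in> parcs (cycle_graph n)"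
    if "a < n" "n \<ge> 2" for a
  proof -
    have "a \<noteq> Suc a mod n" using that by (cases "Suc a = n") auto
    with that show "(a, Suc a mod n) \<in> parcs (cycle_graph n)" "(Suc a mod n, a) \<in> parcs (cycle_graph n)"
      by (auto simp: cycle_graph_def)
  qed
  have up: "\<exists>p. awalk a p ((a + d) mod n) \<and> length p = d" if "a < n" "n \<ge> 2" for a d
    using that(1)
  proof (induction d arbitrary: a)
    case 0
    then show ?case by (auto simp: awalk_Nil_iff)
  next
    case (Suc d)
    from Suc.IH[of "Suc a mod n"] \<open>n \<ge> 2\<close>
    obtain p where "awalk (Suc a mod n) p ((Suc a + d) mod n)" "length p = d"
      by (auto simp: mod_simps)
    with arcs[OF Suc.prems \<open>n \<ge> 2\<close>] show ?case
      by (intro exI[of _ "(a, Suc a mod n) # p"]) (auto simp: awalk_Cons_iff)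
  qed
  have down: "\<exists>p. awalk ((a + d) mod n) p a \<and> length p = d" if "a < n" "n \<ge> 2" for a d
  proof (induction d)
    case 0
    from that show ?case by (auto simp: awalk_Nil_iff)
  next
    case (Suc d)
    then obtain p where "awalk ((a + d) mod n) p a" "length p = d" by blast
    with arcs[of "(a + d) mod n"] \<open>n \<ge> 2\<close> show ?case
      by (intro exI[of _ "((a + Suc d) mod n, (a + d) mod n) # p"])
        (auto simp: awalk_Cons_iff mod_simps)
  qed
  have bound: "\<exists>i. \<bar>i\<bar> \<le> int (length p) \<and> int v = (int a + i) mod int n" if "awalk a p v" for a p
    using that
  proof (induction p arbitrary: a)
    case Nil
    with assms show ?case by (intro exI[of _ 0]) (simp add: awalk_Nil_iff)
  next
    case (Cons e p)
    then have e: "e \<in> parcs (cycle_graph n)" "a = fst e" "awalk (snd e) p v"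
      by (auto simp: awalk_Cons_iff)
    from Cons.IH[OF e(3)] obtain i
      where i: "\<bar>i\<bar> \<le> int (length p)" "int v = (int (snd e) + i) mod int n" by blast
    from e consider "snd e = (a + 1) mod n" | "a = (snd e + 1) mod n"
      by (auto simp: cycle_graph_def)
    then show ?case
    proof cases
      case 1
      with i show ?thesis
        by (intro exI[of _ "i + 1"]) (auto simp: zmod_int mod_simps ac_simps)
    next
      case 2
      then have "(int a + (i - 1)) mod int n = (int (snd e) + i) mod int n"
        by (simp add: zmod_int mod_simps)
      with i show ?thesis by (intro exI[of _ "i - 1"]) auto
    qed
  qed
  show ?thesis
  proof
    assume ?L
    then show ?R
    proof
      assume "u = v"
      with assms show ?R by (intro exI[of _ 0]) simp
    next
      assume "graph_dist (cycle_graph n) u v \<le> ereal (real l)"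
      then obtain p where "awalk u p v" "length p \<le> l"
        unfolding graph_dist_le_iff[OF pair_wf_digraph_axioms] by blast
      with bound[of u p] show ?R by (meson of_nat_mono order_trans)
    qed
  next
    assume ?R
    then obtain i where i: "\<bar>i\<bar> \<le> int l" "int v = (int u + i) mod int n" by blast
    have "\<exists>p. awalk u p v \<and> length p \<le> l" if "u \<noteq> v"
    proof (cases "i \<ge> 0")
      case True
      then have "int v = int ((u + nat i) mod n)" using i by (simp add: zmod_int)
      then have "v = (u + nat i) mod n" by linarith
      moreover have "n \<ge> 2" "nat i \<le> l" using assms that i by auto
      ultimately show ?thesis using up[OF assms(1), of "nat i"] by metis
    next
      case False
      \<comment> \<open>For negative \<open>i\<close>, solve for \<open>u\<close> instead: it lies
        \<open>- i\<close> steps ahead of \<open>v\<close>, so the walk from \<open>down\<close>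
        leads from \<open>u\<close> to \<open>v\<close>.\<close>
      then have "int (nat (- i)) = - i" by simp
      then have "int ((v + nat (- i)) mod n) = (int v - i) mod int n"
        unfolding zmod_int of_nat_add by simp
      also have "\<dots> = ((int u + i) mod int n - i) mod int n" unfolding i(2) ..
      also have "\<dots> = int u" unfolding mod_diff_left_eq using assms by simp
      finally have "u = (v + nat (- i)) mod n" by linarith
      moreover have "n \<ge> 2" "nat (- i) \<le> l" using assms that i by auto
      ultimately show ?thesis using down[OF assms(2), of "nat (- i)"] by metis
    qed
    then show ?L unfolding graph_dist_le_iff[OF pair_wf_digraph_axioms] by blast
  qed
qed

text \<open>Membership and adjacency merge into one condition, since a vertex is at distance 0 from
  itself. The cycle version below works the same way.\<close>

lemma dominating_set_path_power_iff:
  "dominating_set (path_power l n) D \<longleftrightarrow>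
     D \<subseteq> {..<n} \<and> (\<forall>v<n. \<exists>u\<in>D. \<bar>int v - int u\<bar> \<le> int l)"
proof -
  have "v \<in> D \<or> (\<exists>u\<in>D. (v, u) \<in> parcs (path_power l n)) \<longleftrightarrow>
      (\<exists>u\<in>D. \<bar>int v - int u\<bar> \<le> int l)" if "v < n" "D \<subseteq> {..<n}" for v
  proof -
    have "v \<in> D \<or> (\<exists>u\<in>D. (v, u) \<in> parcs (path_power l n)) \<longleftrightarrow>
        (\<exists>u\<in>D. v = u \<or> (v, u) \<in> parcs (path_power l n))" by auto
    also have "\<dots> \<longleftrightarrow> (\<exists>u\<in>D. \<bar>int v - int u\<bar> \<le> int l)"
    proof (rule bex_cong[OF refl])
      fix u assume "u \<in> D"
      with that have "u < n" by auto
      with path_graph_dist_le_iff[OF \<open>v < n\<close> this, of l] \<open>v < n\<close>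
      show "v = u \<or> (v, u) \<in> parcs (path_power l n) \<longleftrightarrow> \<bar>int v - int u\<bar> \<le> int l"
        by (auto simp: graph_power_def)
    qed
    finally show ?thesis .
  qed
  then show ?thesis
    unfolding dominating_set_def pverts_simps by blast
qed

lemma dominating_set_cycle_power_iff:
  "dominating_set (cycle_power l n) D \<longleftrightarrow>
     D \<subseteq> {..<n} \<and> (\<forall>v<n. \<exists>u\<in>D. \<exists>i. \<bar>i\<bar> \<le> int l \<and> int u = (int v + i) mod int n)"
proof -
  have "v \<in> D \<or> (\<exists>u\<in>D. (v, u) \<in> parcs (cycle_power l n)) \<longleftrightarrow>
      (\<exists>u\<in>D. \<exists>i. \<bar>i\<bar> \<le> int l \<and> int u = (int v + i) mod int n)" if "v < n" "D \<subseteq> {..<n}" for v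
  proof -
    have "v \<in> D \<or> (\<exists>u\<in>D. (v, u) \<in> parcs (cycle_power l n)) \<longleftrightarrow>
        (\<exists>u\<in>D. v = u \<or> (v, u) \<in> parcs (cycle_power l n))" by auto
    also have "\<dots> \<longleftrightarrow> (\<exists>u\<in>D. \<exists>i. \<bar>i\<bar> \<le> int l \<and> int u = (int v + i) mod int n)"
    proof (rule bex_cong[OF refl])
      fix u assume "u \<in> D"
      with that have "u < n" by auto
      from cycle_graph_dist_le_iff[OF \<open>v < n\<close> this, of l, symmetric] \<open>u < n\<close> \<open>v < n\<close>
      show "v = u \<or> (v, u) \<in> parcs (cycle_power l n) \<longleftrightarrow>
          (\<exists>i. \<bar>i\<bar> \<le> int l \<and> int u = (int v + i) mod int n)"
        by (auto simp: graph_power_def)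
    qed
    finally show ?thesis .
  qed
  then show ?thesis
    unfolding dominating_set_def pverts_simps by blast
qed

section \<open>Sets with bounded gaps\<close>

text \<open>Asking for some larger element within \<open>m\<close> bounds the gap to the next
  element without listing \<open>D\<close> in order.\<close>

definition gaps_le :: "nat \<Rightarrow> nat set \<Rightarrow> bool" where
  "gaps_le m D \<longleftrightarrow> (\<forall>x\<in>D. x < Max D \<longrightarrow> (\<exists>y\<in>D. x < y \<and> y \<le> x + m))"

text \<open>Take for \<open>x\<close> the largest element up to \<open>v\<close>; the larger element
  that \<open>gaps_le\<close> provides for \<open>x\<close> must then exceed
  \<open>v\<close>.\<close>

lemma gaps_leE:
  assumes "gaps_le m D" "finite D" "D \<noteq> {}" "Min D \<le> v" "v < Max D"
  obtains x y where "x \<in> D" "y \<in> D" "x \<le> v" "v < y" "y \<le> x + m"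
proof -
  define x where "x = Max {x \<in> D. x \<le> v}"
  have ne: "finite {x \<in> D. x \<le> v}" "{x \<in> D. x \<le> v} \<noteq> {}"
    using assms Min_in[OF assms(2,3)] by (simp, blast)
  have x: "x \<in> D" "x \<le> v" using Max_in[OF ne] by (auto simp: x_def)
  with assms obtain y where y: "y \<in> D" "x < y" "y \<le> x + m"
    unfolding gaps_le_def by (meson le_less_trans)
  have "v < y"
  proof (rule ccontr)
    assume "\<not> v < y"
    then have "y \<le> x" using y ne by (auto simp: x_def)
    with y show False by simp
  qed
  with x y that show ?thesis by blast
qed

lemma Max_insert_add:
  fixes D :: "nat set"
  assumes "finite D" "D \<noteq> {}"
  shows "Max (insert (Max D + j) D) = Max D + j" "Min (insert (Max D + j) D) = Min D"
proof -
  show "Max (insert (Max D + j) D) = Max D + j" using assms by simp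
  have "Min D \<le> Max D" using assms by (meson Max_ge Min_in)
  then show "Min (insert (Max D + j) D) = Min D"
    using Min_insert[OF assms] by (simp add: min_absorb2)
qed

text \<open>The new maximum creates exactly one new gap, of length \<open>j\<close>, and leaves the
  old gaps alone.\<close>

lemma gaps_le_insert:
  assumes "finite D" "D \<noteq> {}" "j \<ge> 1"
  shows "gaps_le m (insert (Max D + j) D) \<longleftrightarrow> gaps_le m D \<and> j \<le> m"
proof -
  have le: "x \<le> Max D" if "x \<in> D" for x using that assms by simp
  have Max: "Max D \<in> D" using assms by simp
  show ?thesis
  proof
    assume *: "gaps_le m (insert (Max D + j) D)"
    then have **: "\<exists>y\<in>insert (Max D + j) D. x < y \<and> y \<le> x + m" if "x \<in> D" for x
      using that le[OF that] \<open>j \<ge> 1\<close> unfolding gaps_le_def Max_insert_add[OF assms(1,2)] by auto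
    have "j \<le> m" using **[OF Max] le by force
    moreover have "gaps_le m D"
      unfolding gaps_le_def
    proof (intro ballI impI)
      fix x assume "x \<in> D" "x < Max D"
      then obtain y where y: "y \<in> insert (Max D + j) D" "x < y" "y \<le> x + m" using ** by blast
      show "\<exists>y\<in>D. x < y \<and> y \<le> x + m"
      proof (cases "y \<in> D")
        \<comment> \<open>Here \<open>y\<close> is the new maximum. The old maximum lies strictly
          between \<open>x\<close> and \<open>y\<close>, so it can replace \<open>y\<close> as
          witness.\<close>
        case False
        with y \<open>x < Max D\<close> Max show ?thesis by (intro bexI[of _ "Max D"]) auto
      qed (use y in blast)
    qed
    ultimately show "gaps_le m D \<and> j \<le> m" by simp
  next
    assume *: "gaps_le m D \<and> j \<le> m"
    show "gaps_le m (insert (Max D + j) D)"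
      unfolding gaps_le_def Max_insert_add[OF assms(1,2)]
    proof (intro ballI impI)
      fix x assume x: "x \<in> insert (Max D + j) D" "x < Max D + j"
      then have "x \<in> D" by auto
      show "\<exists>y\<in>insert (Max D + j) D. x < y \<and> y \<le> x + m"
      proof (cases "x = Max D")
        case True
        with x * show ?thesis by auto
      next
        case False
        with le[OF \<open>x \<in> D\<close>] \<open>x \<in> D\<close> * show ?thesis unfolding gaps_le_def by auto
      qed
    qed
  qed
qed

text \<open>Leaving the end condition \<open>R\<close> open lets paths and cycles share one counting
  argument. Measuring the right end as \<open>n - Max D\<close> makes it invariant when the last gap
  is cut off, and makes its sum with \<open>Min D\<close> the gap across the seam of a
  cycle.\<close>

definition gap_sets :: "(nat \<Rightarrow> nat \<Rightarrow> bool) \<Rightarrow> nat \<Rightarrow> nat \<Rightarrow> nat set set" where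
  "gap_sets R m n = {D. D \<subseteq> {..<n} \<and> D \<noteq> {} \<and> R (Min D) (n - Max D) \<and> gaps_le m D}"

lemma gap_setsD:
  assumes "D \<in> gap_sets R m n"
  shows "finite D" "D \<noteq> {}" "Max D < n"
proof -
  show "finite D" "D \<noteq> {}" using assms finite_subset by (auto simp: gap_sets_def)
  then show "Max D < n" using assms Max_in[of D] by (auto simp: gap_sets_def)
qed

lemma finite_gap_sets [simp]: "finite (gap_sets R m n)"
  by (rule finite_subset[of _ "Pow {..<n}"]) (auto simp: gap_sets_def)

lemma insert_mem_gap_sets_iff:
  assumes "finite D" "D \<noteq> {}" "j \<ge> 1"
  shows "insert (Max D + j) D \<in> gap_sets R m n \<longleftrightarrow> j \<le> m \<and> D \<in> gap_sets R m (n - j)"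
proof -
  have le: "x \<le> Max D" if "x \<in> D" for x using that assms by simp
  have "insert (Max D + j) D \<subseteq> {..<n} \<longleftrightarrow> D \<subseteq> {..<n - j}"
  proof
    assume "insert (Max D + j) D \<subseteq> {..<n}"
    then have "Max D + j < n" by simp
    with le show "D \<subseteq> {..<n - j}" by fastforce
  next
    assume *: "D \<subseteq> {..<n - j}"
    with assms Max_in[of D] have "Max D < n - j" by blast
    with * show "insert (Max D + j) D \<subseteq> {..<n}" by auto
  qed
  \<comment> \<open>Both arguments of \<open>R\<close> are unchanged: \<open>Min D\<close> stays,
    and this identity holds even for truncated subtraction.\<close>
  moreover have "n - (Max D + j) = n - j - Max D" by simp
  ultimately show ?thesis
    unfolding gap_sets_def mem_Collect_eq gaps_le_insert[OF assms] Max_insert_add[OF assms(1,2)]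
    using assms(2) by auto
qed

text \<open>Removing the maximum of \<open>D\<close> and recording the last gap \<open>j\<close> is
  a bijection. Two elements are required so that the remaining set is nonempty and again has a
  maximum.\<close>

lemma sum_gap_sets_card_ge_2:
  "(\<Sum>D | D \<in> gap_sets R m n \<and> 2 \<le> card D. f (card D)) =
   (\<Sum>j = 1..m. \<Sum>D\<in>gap_sets R m (n - j). f (Suc (card D)))"
proof -
  have remove: "finite (D - {Max D})" "D - {Max D} \<noteq> {}" "Max (D - {Max D}) < Max D"
    "insert (Max D) (D - {Max D}) = D" if "finite D" "2 \<le> card D" for D :: "nat set"
  proof -
    have "D \<noteq> {}" using that by auto
    then have Max: "Max D \<in> D" using that by simp
    then have "card (D - {Max D}) \<noteq> 0" using that by (simp add: card_Diff_singleton)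
    then show ne: "D - {Max D} \<noteq> {}" by (metis card.empty)
    show fin: "finite (D - {Max D})" using that by simp
    have "Max (D - {Max D}) \<in> D - {Max D}" using Max_in[OF fin ne] .
    with that show "Max (D - {Max D}) < Max D" by (metis Diff_iff Max_ge insertI1 le_neq_implies_less)
    show "insert (Max D) (D - {Max D}) = D" using Max by auto
  qed
  have notin: "Max D + j \<notin> D" if "finite D" "j \<ge> 1" for D :: "nat set" and j
  proof
    assume "Max D + j \<in> D"
    then have "Max D + j \<le> Max D" using that by (intro Max_ge)
    with that show False by simp
  qed
  have "(\<Sum>D | D \<in> gap_sets R m n \<and> 2 \<le> card D. f (card D)) =
    (\<Sum>(j, D) \<in> (SIGMA j:{1..m}. gap_sets R m (n - j)). f (Suc (card D)))"
  \<comment> \<open>Goals 1 and 3 say that the two maps are mutually inverse, 2 and 4 that they land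
    in the right sets, and 5 that the summands agree.\<close>
  proof (rule sum.reindex_bij_witness[where
        j = "\<lambda>D. (Max D - Max (D - {Max D}), D - {Max D})" and
        i = "\<lambda>(j, D). insert (Max D + j) D"], goal_cases)
    case (1 D)
    then have "finite D" by (auto dest: gap_setsD)
    with 1 remove[of D] show ?case by auto
  next
    case (2 D)
    then have "finite D" "2 \<le> card D" by (auto dest: gap_setsD)
    note r = remove[OF this]
    define E j where "E = D - {Max D}" and "j = Max D - Max E"
    have "1 \<le> j" "Max E + j = Max D" using r(3) by (auto simp: E_def j_def)
    then have "D \<in> gap_sets R m n \<longleftrightarrow> j \<le> m \<and> E \<in> gap_sets R m (n - j)"
      using insert_mem_gap_sets_iff[of E j R m n] r by (simp add: E_def)
    with 2 \<open>1 \<le> j\<close> have "(j, E) \<in> (SIGMA j:{1..m}. gap_sets R m (n - j))" by simp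
    then show ?case unfolding j_def E_def .
  next
    case (3 jD)
    then obtain j D where jD: "jD = (j, D)" "j \<ge> 1" "D \<in> gap_sets R m (n - j)" by auto
    note D = gap_setsD[OF jD(3)]
    have "insert (Max D + j) D - {Max D + j} = D" using notin[OF D(1) jD(2)] by blast
    then show ?case unfolding jD(1) prod.case Max_insert_add(1)[OF D(1,2)] by simp
  next
    case (4 jD)
    then obtain j D where jD: "jD = (j, D)" "j \<ge> 1" "j \<le> m" "D \<in> gap_sets R m (n - j)" by auto
    note D = gap_setsD[OF jD(4)]
    have "card D \<noteq> 0" using D by simp
    then have "2 \<le> card (insert (Max D + j) D)" using notin[OF D(1) jD(2)] D(1)
      by (simp add: Suc_le_eq card_gt_0_iff)
    with jD show ?case using insert_mem_gap_sets_iff[OF D(1,2) jD(2), of R m n] by simp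
  next
    case (5 D)
    then have "finite D" "2 \<le> card D" by (auto dest: gap_setsD)
    note r = remove[OF this]
    have "card D = Suc (card (D - {Max D}))"
      using r by (metis DiffD2 card_insert_disjoint singletonI)
    then show ?case by simp
  qed
  also have "\<dots> = (\<Sum>j = 1..m. \<Sum>D\<in>gap_sets R m (n - j). f (Suc (card D)))"
    by (simp add: sum.Sigma)
  finally show ?thesis .
qed

text \<open>The empty set is excluded, and for a singleton the gap condition is vacuous while
  minimum and maximum coincide, so only \<open>R\<close> remains.\<close>

lemma gap_sets_card_less_2:
  "{D \<in> gap_sets R m n. \<not> 2 \<le> card D} = (\<lambda>a. {a}) ` {a. a < n \<and> R a (n - a)}"
proof (intro equalityI subsetI)
  fix D assume D: "D \<in> {D \<in> gap_sets R m n. \<not> 2 \<le> card D}"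
  then have "finite D" "D \<noteq> {}" by (auto dest: gap_setsD)
  then have "card D \<noteq> 0" by simp
  with D have "card D = 1" by auto
  then obtain a where "D = {a}" by (auto simp: card_1_singleton_iff)
  with D show "D \<in> (\<lambda>a. {a}) ` {a. a < n \<and> R a (n - a)}"
    by (auto simp: gap_sets_def)
qed (auto simp: gap_sets_def gaps_le_def)

section \<open>Dominating sets as sets with bounded gaps\<close>

lemma dominating_set_path_power_iff_gaps:
  assumes "n \<ge> 1"
  shows "dominating_set (path_power l n) D \<longleftrightarrow>
    D \<in> gap_sets (\<lambda>a b. a \<le> l \<and> b \<le> l + 1) (2 * l + 1) n"
proof
  assume "dominating_set (path_power l n) D"
  then have sub: "D \<subseteq> {..<n}" and dom: "\<And>v. v < n \<Longrightarrow> \<exists>u\<in>D. \<bar>int v - int u\<bar> \<le> int l"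
    by (auto simp: dominating_set_path_power_iff)
  have fin: "finite D" using sub finite_subset by auto
  \<comment> \<open>The first and the last vertex of the path force the two end conditions.\<close>
  obtain a where a: "a \<in> D" "a \<le> l" using dom[of 0] assms by force
  obtain b where b: "b \<in> D" "n \<le> b + (l + 1)" using dom[of "n - 1"] assms by force
  have "Min D \<le> l" using a fin by (meson Min_le le_trans)
  moreover have "n - Max D \<le> l + 1" using b Max_ge[OF fin b(1)] by linarith
  moreover have "gaps_le (2 * l + 1) D"
    unfolding gaps_le_def
  proof (intro ballI impI)
    fix x assume x: "x \<in> D" "x < Max D"
    have Max: "Max D \<in> D" using fin x by (intro Max_in) auto
    show "\<exists>y\<in>D. x < y \<and> y \<le> x + (2 * l + 1)"
    proof (cases "x + l + 1 < n")
      case True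
      \<comment> \<open>\<open>x + l + 1\<close> is the first vertex above \<open>x\<close> out of
        its reach; whatever dominates it lies between \<open>x + 1\<close> and
        \<open>x + 2 * l + 1\<close>. If this vertex does not exist, \<open>Max D\<close> itself is
        close enough to \<open>x\<close>.\<close>
      from dom[OF this] obtain u where "u \<in> D" "\<bar>int (x + l + 1) - int u\<bar> \<le> int l" by blast
      then show ?thesis by (intro bexI[of _ u]) auto
    next
      case False
      with Max x sub show ?thesis by (intro bexI[of _ "Max D"]) auto
    qed
  qed
  ultimately show "D \<in> gap_sets (\<lambda>a b. a \<le> l \<and> b \<le> l + 1) (2 * l + 1) n"
    using a sub by (auto simp: gap_sets_def)
next
  assume D: "D \<in> gap_sets (\<lambda>a b. a \<le> l \<and> b \<le> l + 1) (2 * l + 1) n"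
  note fin = gap_setsD[OF D]
  from D have ends: "Min D \<le> l" "n - Max D \<le> l + 1" and gaps: "gaps_le (2 * l + 1) D"
    and sub: "D \<subseteq> {..<n}"
    by (auto simp: gap_sets_def)
  have "\<exists>u\<in>D. \<bar>int v - int u\<bar> \<le> int l" if "v < n" for v
  proof -
    consider "v < Min D" | "Max D \<le> v" | "Min D \<le> v" "v < Max D" by linarith
    then show ?thesis
    proof cases
      case 1
      with ends Min_in[OF fin(1,2)] show ?thesis by (intro bexI[of _ "Min D"]) auto
    next
      case 2
      with ends that Max_in[OF fin(1,2)] show ?thesis by (intro bexI[of _ "Max D"]) auto
    next
      case 3
      from gaps_leE[OF gaps fin(1,2) 3]
      obtain x y where xy: "x \<in> D" "y \<in> D" "x \<le> v" "v < y" "y \<le> x + (2 * l + 1)" .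
      \<comment> \<open>The distances from \<open>v\<close> to \<open>x\<close> and to
        \<open>y\<close> add up to at most \<open>2 * l + 1\<close>, so they cannot both exceed
        \<open>l\<close>.\<close>
      then have "\<bar>int v - int x\<bar> \<le> int l \<or> \<bar>int v - int y\<bar> \<le> int l" by linarith
      with xy show ?thesis by blast
    qed
  qed
  with sub show "dominating_set (path_power l n) D"
    by (simp add: dominating_set_path_power_iff)
qed

lemma dominating_set_cycle_power_iff_gaps:
  assumes "n \<ge> 1"
  shows "dominating_set (cycle_power l n) D \<longleftrightarrow>
    D \<in> gap_sets (\<lambda>a b. a + b \<le> 2 * l + 1) (2 * l + 1) n"
proof
  assume "dominating_set (cycle_power l n) D"
  then have sub: "D \<subseteq> {..<n}"
    and dom: "\<And>v. v < n \<Longrightarrow> \<exists>u\<in>D. \<exists>i. \<bar>i\<bar> \<le> int l \<and> int u = (int v + i) mod int n"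
    by (auto simp: dominating_set_cycle_power_iff)
  have fin: "finite D" using sub finite_subset by auto
  have ne: "D \<noteq> {}" using dom[of 0] assms by auto
  have Max: "Max D \<in> D" "Max D < n" using Max_in[OF fin ne] sub by auto
  have "Min D + (n - Max D) \<le> 2 * l + 1"
  proof (rule ccontr)
    assume gap: "\<not> ?thesis"
    \<comment> \<open>If the gap across the seam were longer, the vertex \<open>l + 1\<close> steps
      after \<open>Max D\<close> would be undominated. Its supposed dominator has an unreduced
      position \<open>w\<close> strictly between \<open>Max D\<close> and \<open>Min D + n\<close>,
      so its residue lies above \<open>Max D\<close> or below \<open>Min D\<close>.\<close>
    have "(Max D + l + 1) mod n < n" using assms by simp
    from dom[OF this] obtain u i where u: "u \<in> D" "\<bar>i\<bar> \<le> int l"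
      "int u = (int (Max D + l + 1) + i) mod int n"
      by (auto simp: zmod_int mod_simps)
    define w where "w = nat (int (Max D + l + 1) + i)"
    have w: "Max D < w" "w \<le> Max D + (2 * l + 1)" using u(2) by (auto simp: w_def)
    have "int u = int (w mod n)" using u by (simp add: w_def zmod_int)
    then have uw: "u = w mod n" by linarith
    have "Min D \<le> u" "u \<le> Max D" using fin u by auto
    show False
    proof (cases "w < n")
      case True
      with uw w \<open>u \<le> Max D\<close> show False by simp
    next
      case False
      have "Min D < n" using \<open>Min D \<le> u\<close> sub u by force
      with False w gap Max have "w - n < n" by linarith
      with False have "w mod n = w - n" by (simp add: le_mod_geq)
      with uw w gap \<open>Min D \<le> u\<close> False Max show False by linarith
    qed
  qed
  moreover have "gaps_le (2 * l + 1) D"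
    unfolding gaps_le_def
  proof (intro ballI impI)
    fix x assume x: "x \<in> D" "x < Max D"
    show "\<exists>y\<in>D. x < y \<and> y \<le> x + (2 * l + 1)"
    \<comment> \<open>In the first case the dominator of \<open>x + l + 1\<close> is reached without
      wrapping around; otherwise \<open>Max D\<close> is already within \<open>2 * l + 1\<close> of
      \<open>x\<close>.\<close>
    proof (cases "x + (2 * l + 1) < n")
      case True
      then have "x + l + 1 < n" by simp
      from dom[OF this] obtain u i
        where u: "u \<in> D" "\<bar>i\<bar> \<le> int l" "int u = (int (x + l + 1) + i) mod int n" by blast
      have "int u = int (x + l + 1) + i"
        unfolding u(3) by (rule mod_pos_pos_trivial) (use u(2) True in auto)
      with u show ?thesis by (intro bexI[of _ u]) auto
    next
      case False
      with Max x show ?thesis by (intro bexI[of _ "Max D"]) auto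
    qed
  qed
  ultimately show "D \<in> gap_sets (\<lambda>a b. a + b \<le> 2 * l + 1) (2 * l + 1) n"
    using ne sub by (auto simp: gap_sets_def)
next
  assume D: "D \<in> gap_sets (\<lambda>a b. a + b \<le> 2 * l + 1) (2 * l + 1) n"
  note fin = gap_setsD[OF D]
  from D have ends: "Min D + (n - Max D) \<le> 2 * l + 1" and gaps: "gaps_le (2 * l + 1) D"
    and sub: "D \<subseteq> {..<n}"
    by (auto simp: gap_sets_def)
  have Min: "Min D \<in> D" "Min D < n" and Max: "Max D \<in> D" "Max D < n"
    using Min_in[OF fin(1,2)] Max_in[OF fin(1,2)] sub by auto
  \<comment> \<open>Unroll the cycle: a vertex is dominated if \<open>x\<close> or one of its
    translates by \<open>n\<close> is within \<open>l\<close>. This turns the seam into an ordinary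
    gap, between \<open>Max D - n\<close> and \<open>Min D\<close> or between \<open>Max D\<close>
    and \<open>Min D + n\<close>.\<close>
  have near: "\<exists>u\<in>D. \<exists>i. \<bar>i\<bar> \<le> int l \<and> int u = (int v + i) mod int n"
    if "x \<in> D" "k = int x \<or> k = int x + int n \<or> k = int x - int n" "\<bar>k - int v\<bar> \<le> int l" for v x k
    using that sub by (intro bexI[of _ x] exI[of _ "k - int v"]) auto
  have "\<exists>u\<in>D. \<exists>i. \<bar>i\<bar> \<le> int l \<and> int u = (int v + i) mod int n" if "v < n" for v
  proof -
    consider "v < Min D" | "Max D \<le> v" | "Min D \<le> v" "v < Max D" by linarith
    then show ?thesis
    proof cases
      case 1
      with ends that Max have
        "\<bar>int (Min D) - int v\<bar> \<le> int l \<or> \<bar>(int (Max D) - int n) - int v\<bar> \<le> int l"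
        by linarith
      with near Min(1) Max(1) show ?thesis by blast
    next
      case 2
      with ends that Max have
        "\<bar>int (Max D) - int v\<bar> \<le> int l \<or> \<bar>(int (Min D) + int n) - int v\<bar> \<le> int l"
        by linarith
      with near Min(1) Max(1) show ?thesis by blast
    next
      case 3
      from gaps_leE[OF gaps fin(1,2) 3]
      obtain x y where xy: "x \<in> D" "y \<in> D" "x \<le> v" "v < y" "y \<le> x + (2 * l + 1)" .
      then have "\<bar>int x - int v\<bar> \<le> int l \<or> \<bar>int y - int v\<bar> \<le> int l" by linarith
      with xy near show ?thesis by blast
    qed
  qed
  with sub show "dominating_set (cycle_power l n) D"
    by (simp add: dominating_set_cycle_power_iff)
qed

section \<open>The recurrences\<close>

text \<open>Summing over the sets themselves instead of over sizes lets the bijection act summand by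
  summand.\<close>

lemma domination_poly_altdef:
  assumes "finite (pverts G)"
  shows "domination_poly G = (\<Sum>D | dominating_set G D. monom 1 (card D))"
proof (rule poly_eqI)
  fix k
  have fin: "finite {D. dominating_set G D}"
    by (rule finite_subset[of _ "Pow (pverts G)"]) (auto simp: dominating_set_def assms)
  have "coeff (\<Sum>D | dominating_set G D. monom (1 :: int) (card D)) k =
      (\<Sum>D | dominating_set G D. if card D = k then 1 else 0)"
    by (simp add: coeff_sum)
  also have "\<dots> = int (num_dominating_sets G k)"
    using fin by (simp add: num_dominating_sets_def sum.If_cases Int_def)
  finally show "coeff (domination_poly G) k =
      coeff (\<Sum>D | dominating_set G D. monom 1 (card D)) k"
    using coeff_domination_poly[OF assms] by simp
qed

definition gap_poly :: "(nat \<Rightarrow> nat \<Rightarrow> bool) \<Rightarrow> nat \<Rightarrow> nat \<Rightarrow> int poly" where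
  "gap_poly R m n = (\<Sum>D\<in>gap_sets R m n. monom 1 (card D))"

lemma gap_poly_0 [simp]: "gap_poly R m 0 = 0"
  by (simp add: gap_poly_def gap_sets_def)

text \<open>Each admissible singleton contributes \<open>x\<close>; in larger sets the deleted
  maximum accounts for the factor \<open>x\<close>. Indices with \<open>j \<ge> n\<close> contribute
  0 because \<open>gap_sets\<close> is empty on no vertices.\<close>

lemma gap_poly_recurrence:
  "gap_poly R m n =
     [:0, 1:] * (of_nat (card {a. a < n \<and> R a (n - a)}) + (\<Sum>j = 1..m. gap_poly R m (n - j)))"
proof -
  have x: "[:0, 1:] * monom 1 k = monom (1 :: int) (Suc k)" for k
    by (simp add: monom_Suc)
  have "gap_poly R m n =
      (\<Sum>D | D \<in> gap_sets R m n \<and> \<not> 2 \<le> card D. monom 1 (card D)) +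
      (\<Sum>D | D \<in> gap_sets R m n \<and> 2 \<le> card D. monom 1 (card D))"
    unfolding gap_poly_def
    by (subst sum.union_disjoint[symmetric]) (auto intro!: sum.cong)
  also have "(\<Sum>D | D \<in> gap_sets R m n \<and> \<not> 2 \<le> card D. monom (1 :: int) (card D)) =
      [:0, 1:] * of_nat (card {a. a < n \<and> R a (n - a)})"
    unfolding gap_sets_card_less_2
    by (subst sum.reindex) (auto simp: inj_on_def monom_Suc monom_0 mult.commute)
  also have "(\<Sum>D | D \<in> gap_sets R m n \<and> 2 \<le> card D. monom (1 :: int) (card D)) =
      [:0, 1:] * (\<Sum>j = 1..m. gap_poly R m (n - j))"
    unfolding sum_gap_sets_card_ge_2 gap_poly_def x[symmetric] sum_distrib_left ..
  finally show ?thesis by (simp only: distrib_left)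
qed

text \<open>The correction at \<open>n = 0\<close> is the empty set, which dominates the empty graph
  but is not a gap set.\<close>

lemma domination_poly_path_power:
  "domination_poly (path_power l n) =
     gap_poly (\<lambda>a b. a \<le> l \<and> b \<le> l + 1) (2 * l + 1) n + (if n = 0 then 1 else 0)"
proof (cases "n = 0")
  case True
  then show ?thesis
    by (simp add: domination_poly_no_vertices)
next
  case False
  have "finite (pverts (path_power l n))" by simp
  with False show ?thesis
    by (simp add: domination_poly_altdef dominating_set_path_power_iff_gaps gap_poly_def)
qed

lemma domination_poly_cycle_power:
  assumes "n \<ge> 1"
  shows "domination_poly (cycle_power l n) =
     gap_poly (\<lambda>a b. a + b \<le> 2 * l + 1) (2 * l + 1) n"
proof -
  have "finite (pverts (cycle_power l n))" by simp
  then show ?thesis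
    using assms
    by (simp add: domination_poly_altdef dominating_set_cycle_power_iff_gaps gap_poly_def)
qed

text \<open>Two exceptional terms match. A single vertex dominates only if
  \<open>n \<le> 2 * l + 1\<close>, so here only the middle vertex \<open>l\<close> of the path with
  \<open>n = 2 * l + 1\<close> does; for the same \<open>n\<close> the summand \<open>j = n\<close>
  is the polynomial 1 of the empty graph.\<close>

lemma domination_poly_path_power_recurrence:
  assumes "n \<ge> 2 * l + 1"
  shows "domination_poly (path_power l n) =
    [:0, 1:] * (\<Sum>j = 1..2 * l + 1. domination_poly (path_power l (n - j)))"
proof -
  let ?R = "\<lambda>a b. a \<le> l \<and> b \<le> l + 1"
  have "{a. a < n \<and> ?R a (n - a)} = (if n = 2 * l + 1 then {l} else {})"
    using assms by auto
  \<comment> \<open>Since \<open>j \<le> 2 * l + 1 \<le> n\<close>, the truncated difference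
    vanishes only for \<open>j = n\<close>.\<close>
  moreover have "(\<Sum>j = 1..2 * l + 1. if n - j = 0 then 1 else 0 :: int poly) =
      (\<Sum>j = 1..2 * l + 1. if n = j then 1 else 0)"
    using assms by (intro sum.cong) auto
  then have "(\<Sum>j = 1..2 * l + 1. if n - j = 0 then 1 else 0 :: int poly) =
      (if n = 2 * l + 1 then 1 else 0)"
    using assms by simp
  ultimately have "(\<Sum>j = 1..2 * l + 1. domination_poly (path_power l (n - j))) =
      of_nat (card {a. a < n \<and> ?R a (n - a)}) + (\<Sum>j = 1..2 * l + 1. gap_poly ?R (2 * l + 1) (n - j))"
    by (simp add: domination_poly_path_power sum.distrib)
  then show ?thesis
    using assms gap_poly_recurrence[of ?R "2 * l + 1" n] by (simp add: domination_poly_path_power)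
qed

text \<open>For a singleton the seam gap is \<open>n\<close> itself, which is now too large, and
  every \<open>n - j\<close> is positive. Neither exceptional term of the path case arises.\<close>

lemma domination_poly_cycle_power_recurrence:
  assumes "n \<ge> 2 * l + 2"
  shows "domination_poly (cycle_power l n) =
    [:0, 1:] * (\<Sum>j = 1..2 * l + 1. domination_poly (cycle_power l (n - j)))"
proof -
  let ?R = "\<lambda>a b. a + b \<le> 2 * l + 1"
  have "{a. a < n \<and> ?R a (n - a)} = {}" using assms by auto
  moreover have "(\<Sum>j = 1..2 * l + 1. domination_poly (cycle_power l (n - j))) =
      (\<Sum>j = 1..2 * l + 1. gap_poly ?R (2 * l + 1) (n - j))"
    using assms by (intro sum.cong refl domination_poly_cycle_power) auto
  ultimately show ?thesis
    using assms gap_poly_recurrence[of ?R "2 * l + 1" n] by (simp add: domination_poly_cycle_power)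
qed

theorem theorem4:
  fixes l :: nat
  assumes "l \<ge> 1"
  shows "(\<forall>n \<ge> 2 * l + 1.
            domination_poly (path_power l n) =
              [:0, 1:] * (\<Sum>j = 1..2 * l + 1. domination_poly (path_power l (n - j)))) \<and>
         (\<forall>n \<ge> 2 * l + 2.
            domination_poly (cycle_power l n) =
              [:0, 1:] * (\<Sum>j = 1..2 * l + 1. domination_poly (cycle_power l (n - j))))"
  using domination_poly_path_power_recurrence domination_poly_cycle_power_recurrence by blast

end
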